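(* Let $\varepsilon>0$, let $\mathcal{H}_1$ and $\mathcal{H}_2$ be finite-dimensional Hilbert spaces, let $C$ be a Hermitian operator on $\mathcal{H}_1\otimes\mathcal{H}_2$, and let $\rho\in\mathrm{H}_{\geq}(\mathcal{H}_1)$, $\sigma\in\mathrm{H}_{\geq}(\mathcal{H}_2)$ be Hermitian positive semi-definite operators. Then the family $\{\mathcal{F}^{\tau}_{\varepsilon}\}_{\tau>0}$, where $$\mathcal{F}^{\tau}_{\varepsilon}(\Gamma)=\mathrm{Tr}[C\Gamma]+\varepsilon\mathcal{S}[\Gamma]+\tau\left(\mathcal{E}[\Gamma_1|\rho]+\mathcal{E}[\Gamma_2|\sigma]\right),\qquad \Gamma\in\mathrm{H}_{\geq}(\mathcal{H}_1\otimes\mathcal{H}_2),$$ $\Gamma$-converges in the weak*-topology, as $\tau\to+\infty$, to $$\mathcal{F}^{\infty}_{\varepsilon}(\Gamma)=\mathrm{Tr}[C\Gamma]+\varepsilon\mathcal{S}[\Gamma]+\begin{cases}0,&\Gamma_1=\rho\text{ and }\Gamma_2=\sigma,\\+\infty,&\text{otherwise},\end{cases}$$ which, in particular, is equal to the von Neumann entropy regularized Non-commutative Optimal Transport functional (i.e. $\Gamma\mapsto\mathrm{Tr}[C\Gamma]+\varepsilon\mathcal{S}[\Gamma]$ constrained to density matrices $\Gamma$ on $\mathcal{H}_1\otimes\mathcal{H}_2$ with partial traces $\rho$ and $\sigma$) when $\rho$ and $\sigma$ are density matrices.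
   Context: $\mathrm{H}_{\geq}(\mathcal{H})$ is the set of Hermitian positive semi-definite operators on $\mathcal{H}$; a density matrix is such an operator with trace one. The partial traces of $\Gamma$ are $\Gamma_1=\mathrm{Tr}_2[\Gamma]$ (on $\mathcal{H}_1$) and $\Gamma_2=\mathrm{Tr}_1[\Gamma]$ (on $\mathcal{H}_2$). The von Neumann entropy is $\mathcal{S}[\Gamma]=\mathrm{Tr}[\Gamma(\log\Gamma-\mathrm{Id})]$. The Umegaki relative entropy of $\gamma_1,\gamma_2\in\mathrm{H}_{\geq}(\mathcal{H})$ is $$\mathcal{E}[\gamma_1|\gamma_2]=\mathrm{Tr}[\gamma_1(\log\gamma_1-\log\gamma_2-\mathrm{Id})+\gamma_2]\ \text{ if }\ker\gamma_2\subset\ker\gamma_1,\qquad \mathcal{E}[\gamma_1|\gamma_2]=+\infty\ \text{ otherwise},$$ with $0\log0=0$ ($\mathrm{Tr}[\gamma_1\log\gamma_2]$ being computed on the range of $\gamma_2$). All functionals take values in $\mathbb{R}\cup\{+\infty\}$. $\Gamma$-convergence: a family $\mathcal{F}_\alpha$ of functionals on a topological space $\mathcal{X}$ $\Gamma$-converges to $\mathcal{F}$ if (i) for every $x_\alpha\to x$, $\mathcal{F}(x)\leq\liminf_\alpha\mathcal{F}_\alpha(x_\alpha)$; and (ii) for every $x\in\mathcal{X}$ there exists $x_\alpha\to x$ with $\mathcal{F}(x)\geq\limsup_\alpha\mathcal{F}_\alpha(x_\alpha)$. Here $\mathcal{X}=\mathrm{H}_{\geq}(\mathcal{H}_1\otimes\mathcal{H}_2)$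 with the weak*-topology (equal to the norm topology in finite dimension), $\alpha=\tau\to+\infty$. *)

theory Defs
  imports "HOL-Analysis.Analysis"
begin

text \<open>
  A finite-dimensional Hilbert space is \<open>complex ^ 'n\<close>, its operators are the matrices
  \<open>complex ^ 'n ^ 'n\<close>, and the tensor product of \<open>complex ^ 'a\<close> and \<open>complex ^ 'b\<close> is
  \<open>complex ^ ('a \<times> 'b)\<close>, the index \<open>(i, k)\<close> standing for the basis vector
  \<open>e\<^sub>i \<otimes> e\<^sub>k\<close>.
\<close>

definition conj_transpose :: "complex ^ 'n ^ 'm \<Rightarrow> complex ^ 'm ^ 'n" where
  "conj_transpose A = (\<chi> i j. cnj (A $ j $ i))"

definition hermitian :: "complex ^ 'n ^ 'n \<Rightarrow> bool" where
  "hermitian A \<longleftrightarrow> conj_transpose A = A"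

definition unitary :: "complex ^ 'n ^ 'n \<Rightarrow> bool" where
  "unitary U \<longleftrightarrow> conj_transpose U ** U = mat 1 \<and> U ** conj_transpose U = mat 1"

text \<open>On \<open>complex ^ 'n\<close> the library's \<open>\<bullet>\<close> is the real part of the Hermitian inner product;
  for Hermitian \<open>A\<close> the number \<open>\<langle>v, A v\<rangle>\<close> is real, so nothing is lost.\<close>

definition psd :: "complex ^ 'n ^ 'n \<Rightarrow> bool" where
  "psd A \<longleftrightarrow> hermitian A \<and> (\<forall>v. 0 \<le> v \<bullet> (A *v v))"

definition density_matrix :: "complex ^ 'n ^ 'n \<Rightarrow> bool" where
  "density_matrix A \<longleftrightarrow> psd A \<and> trace A = 1"

definition matrix_ker :: "complex ^ 'n ^ 'n \<Rightarrow> (complex ^ 'n) set" where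
  "matrix_ker A = {v. A *v v = 0}"

definition real_diag :: "('n \<Rightarrow> real) \<Rightarrow> complex ^ 'n ^ 'n" where
  "real_diag d = (\<chi> i j. if i = j then complex_of_real (d i) else 0)"

text \<open>Spectral functional calculus. By the spectral theorem a Hermitian \<open>A\<close> has a
  decomposition as below, and \<open>f(A)\<close> does not depend on which one is chosen; the value is
  unspecified if \<open>A\<close> is not Hermitian.\<close>

definition spectral_fun :: "(real \<Rightarrow> real) \<Rightarrow> complex ^ 'n ^ 'n \<Rightarrow> complex ^ 'n ^ 'n" where
  "spectral_fun f A = (THE B. \<exists>U d. unitary U
      \<and> A = U ** real_diag d ** conj_transpose U
      \<and> B = U ** real_diag (f \<circ> d) ** conj_transpose U)"

text \<open>The logarithm on the range of a positive semi-definite matrix, extended by \<open>0\<close> to its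
  kernel. This encodes \<open>0 log 0 = 0\<close>, and makes \<open>trace (\<gamma>\<^sub>1 ** matrix_log \<gamma>\<^sub>2)\<close> a trace over the
  range of \<open>\<gamma>\<^sub>2\<close>.\<close>

definition matrix_log :: "complex ^ 'n ^ 'n \<Rightarrow> complex ^ 'n ^ 'n" where
  "matrix_log = spectral_fun (\<lambda>x. if x = 0 then 0 else ln x)"

definition partial_trace_2 :: "complex ^ ('a::finite \<times> 'b::finite) ^ ('a \<times> 'b) \<Rightarrow> complex ^ 'a ^ 'a" where
  "partial_trace_2 \<Gamma> = (\<chi> i j. \<Sum>k\<in>UNIV. \<Gamma> $ (i, k) $ (j, k))"

definition partial_trace_1 :: "complex ^ ('a::finite \<times> 'b::finite) ^ ('a \<times> 'b) \<Rightarrow> complex ^ 'b ^ 'b" where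
  "partial_trace_1 \<Gamma> = (\<chi> k l. \<Sum>i\<in>UNIV. \<Gamma> $ (i, k) $ (i, l))"

text \<open>The traces below are real for Hermitian arguments; \<open>Re\<close> only changes the type.\<close>

definition von_neumann_entropy :: "complex ^ 'n ^ 'n \<Rightarrow> real" where
  "von_neumann_entropy \<Gamma> = Re (trace (\<Gamma> ** (matrix_log \<Gamma> - mat 1)))"

definition relative_entropy :: "complex ^ 'n ^ 'n \<Rightarrow> complex ^ 'n ^ 'n \<Rightarrow> ereal" where
  "relative_entropy \<gamma>\<^sub>1 \<gamma>\<^sub>2 =
    (if matrix_ker \<gamma>\<^sub>2 \<subseteq> matrix_ker \<gamma>\<^sub>1
     then ereal (Re (trace (\<gamma>\<^sub>1 ** (matrix_log \<gamma>\<^sub>1 - matrix_log \<gamma>\<^sub>2 - mat 1) + \<gamma>\<^sub>2)))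
     else \<infinity>)"

definition regularized_cost :: "complex ^ 'n ^ 'n \<Rightarrow> real \<Rightarrow> complex ^ 'n ^ 'n \<Rightarrow> real" where
  "regularized_cost C \<epsilon> \<Gamma> = Re (trace (C ** \<Gamma>)) + \<epsilon> * von_neumann_entropy \<Gamma>"

definition unbalanced_functional ::
    "complex ^ ('a::finite \<times> 'b::finite) ^ ('a \<times> 'b) \<Rightarrow> complex ^ 'a ^ 'a \<Rightarrow> complex ^ 'b ^ 'b
      \<Rightarrow> real \<Rightarrow> real \<Rightarrow> complex ^ ('a \<times> 'b) ^ ('a \<times> 'b) \<Rightarrow> ereal" where
  "unbalanced_functional C \<rho> \<sigma> \<epsilon> \<tau> \<Gamma> =
    ereal (regularized_cost C \<epsilon> \<Gamma>)
      + ereal \<tau> * (relative_entropy (partial_trace_2 \<Gamma>) \<rho>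
                   + relative_entropy (partial_trace_1 \<Gamma>) \<sigma>)"

definition limit_functional ::
    "complex ^ ('a::finite \<times> 'b::finite) ^ ('a \<times> 'b) \<Rightarrow> complex ^ 'a ^ 'a \<Rightarrow> complex ^ 'b ^ 'b
      \<Rightarrow> real \<Rightarrow> complex ^ ('a \<times> 'b) ^ ('a \<times> 'b) \<Rightarrow> ereal" where
  "limit_functional C \<rho> \<sigma> \<epsilon> \<Gamma> =
    ereal (regularized_cost C \<epsilon> \<Gamma>)
      + (if partial_trace_2 \<Gamma> = \<rho> \<and> partial_trace_1 \<Gamma> = \<sigma> then 0 else \<infinity>)"

text \<open>The entropy-regularized non-commutative optimal transport functional, with the constraint
  expressed by the value \<open>\<infinity>\<close>.\<close>

definition ncot_functional ::
    "complex ^ ('a::finite \<times> 'b::finite) ^ ('a \<times> 'b) \<Rightarrow> complex ^ 'a ^ 'a \<Rightarrow> complex ^ 'b ^ 'b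
      \<Rightarrow> real \<Rightarrow> complex ^ ('a \<times> 'b) ^ ('a \<times> 'b) \<Rightarrow> ereal" where
  "ncot_functional C \<rho> \<sigma> \<epsilon> \<Gamma> =
    (if density_matrix \<Gamma> \<and> partial_trace_2 \<Gamma> = \<rho> \<and> partial_trace_1 \<Gamma> = \<sigma>
     then ereal (regularized_cost C \<epsilon> \<Gamma>) else \<infinity>)"

text \<open>The coarsest topology making \<open>\<Gamma> \<mapsto> trace (A ** \<Gamma>)\<close> continuous for every operator \<open>A\<close>
  (trace-class operators as the dual of the compact operators).\<close>

definition weak_star_topology :: "(complex ^ 'n ^ 'n) topology" where
  "weak_star_topology =
    topology_generated_by {{\<Gamma>. trace (A ** \<Gamma>) \<in> V} | A V. open V}"

definition psd_topology :: "(complex ^ 'n ^ 'n) topology" where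
  "psd_topology = subtopology weak_star_topology {\<Gamma>. psd \<Gamma>}"

lemma topspace_psd_topology: "topspace psd_topology = {\<Gamma>. psd \<Gamma>}"
proof -
  have "UNIV \<in> {{\<Gamma>::complex^'n^'n. trace (A ** \<Gamma>) \<in> V} | A V. open V}"
    by (rule CollectI, rule exI[of _ 0], rule exI[of _ UNIV]) auto
  then show ?thesis
    unfolding psd_topology_def weak_star_topology_def by auto
qed

text \<open>\<open>limitin\<close> makes \<open>\<xi> \<alpha>\<close> lie in the space only for eventually all \<open>\<alpha>\<close>; the other indices
  affect neither the \<open>Liminf\<close> nor the \<open>Limsup\<close>.\<close>

definition gamma_converges ::
    "'x topology \<Rightarrow> ('i \<Rightarrow> 'x \<Rightarrow> ereal) \<Rightarrow> ('x \<Rightarrow> ereal) \<Rightarrow> 'i filter \<Rightarrow> bool" where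
  "gamma_converges X \<Phi> \<phi> F \<longleftrightarrow>
    (\<forall>x\<in>topspace X. \<forall>\<xi>. limitin X \<xi> x F \<longrightarrow> \<phi> x \<le> Liminf F (\<lambda>\<alpha>. \<Phi> \<alpha> (\<xi> \<alpha>))) \<and>
    (\<forall>x\<in>topspace X. \<exists>\<xi>. limitin X \<xi> x F \<and> Limsup F (\<lambda>\<alpha>. \<Phi> \<alpha> (\<xi> \<alpha>)) \<le> \<phi> x)"

end

theory Submission
  imports Defs
begin

text \<open>
  Writing two positive semi-definite matrices in their eigenbases, the scalar inequality
  \<open>a ln (a/b) - a + b \<ge> (\<surd>a - \<surd>b)\<^sup>2\<close> gives Klein's inequality in the quantitative form
  \<open>\<E>[A|B] \<ge> \<parallel>A - B\<parallel>\<^sup>2 / (2 (Tr A + Tr B) + 1)\<close>. If a limit \<open>\<Gamma>\<close> violates a marginal constraint, this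
  makes the penalty \<open>\<tau> (\<E>[\<Gamma>\<^sub>1|\<rho>] + \<E>[\<Gamma>\<^sub>2|\<sigma>])\<close> diverge along every family converging to \<open>\<Gamma>\<close>. Otherwise
  the penalty can be dropped from below, and the liminf inequality is the lower semicontinuity of the
  entropy, which also follows from Klein's inequality: \<open>\<S>[\<Gamma>]\<close> is a supremum of the affine functions
  \<open>Tr[\<Gamma> log G] - Tr G\<close> over positive definite \<open>G\<close>. Constant families are recovery families.
\<close>

section \<open>The spectral theorem for Hermitian matrices\<close>

lemma conj_transpose_nth [simp]: "conj_transpose A $ i $ j = cnj (A $ j $ i)"
  by (simp add: conj_transpose_def)

lemma conj_transpose_conj_transpose [simp]: "conj_transpose (conj_transpose A) = A"
  by (simp add: vec_eq_iff)

lemma conj_transpose_mult: "conj_transpose (A ** B) = conj_transpose B ** conj_transpose A"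
  by (simp add: vec_eq_iff matrix_matrix_mult_def mult.commute)

lemma conj_transpose_diff: "conj_transpose (A - B) = conj_transpose A - conj_transpose B"
  by (simp add: vec_eq_iff)

lemma hermitian_cnj: "hermitian A \<Longrightarrow> cnj (A $ i $ j) = A $ j $ i"
  by (metis conj_transpose_nth hermitian_def)

lemma inner_eq_Re_sum: "x \<bullet> y = Re (\<Sum>i\<in>UNIV. cnj (x $ i) * y $ i)" for x y :: "complex ^ 'n"
  by (simp add: inner_vec_def inner_complex_def sum.distrib)

text \<open>The real inner product sees only the real part of the Hermitian one. Pairing with
  \<open>\<i> *s x\<close> recovers the imaginary part, so real orthogonality to both
  \<open>x\<close> and \<open>\<i> *s x\<close> amounts to complex orthogonality to
  \<open>x\<close>.\<close>

lemma inner_i_eq_Im_sum: "(\<i> *s x) \<bullet> y = Im (\<Sum>i\<in>UNIV. cnj (x $ i) * y $ i)" for x y :: "complex ^ 'n"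
  by (simp add: inner_vec_def inner_complex_def algebra_simps)

lemma matrix_vector_mult_scaleR_complex: "A *v (c *\<^sub>R x) = c *\<^sub>R (A *v x)"
  for A :: "complex ^ 'n ^ 'm"
  by (simp add: vec_eq_iff matrix_vector_mult_def scaleR_sum_right)

lemma inner_matrix_vector_mult:
  fixes A :: "complex ^ 'n ^ 'm"
  shows "x \<bullet> (A *v y) = (conj_transpose A *v x) \<bullet> y"
proof -
  have "(\<Sum>i\<in>UNIV. cnj (x $ i) * (A *v y) $ i) = (\<Sum>i\<in>UNIV. \<Sum>j\<in>UNIV. cnj (x $ i) * (A $ i $ j * y $ j))"
    by (simp add: matrix_vector_mult_def sum_distrib_left)
  also have "\<dots> = (\<Sum>j\<in>UNIV. \<Sum>i\<in>UNIV. cnj (x $ i) * (A $ i $ j * y $ j))"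
    by (rule sum.swap)
  also have "\<dots> = (\<Sum>j\<in>UNIV. cnj ((conj_transpose A *v x) $ j) * y $ j)"
    by (simp add: matrix_vector_mult_def sum_distrib_right sum_distrib_left mult_ac)
  finally show ?thesis by (simp only: inner_eq_Re_sum)
qed

lemma hermitian_inner: "hermitian A \<Longrightarrow> x \<bullet> (A *v y) = (A *v x) \<bullet> y"
  by (simp add: inner_matrix_vector_mult hermitian_def)

text \<open>First variation: the form \<open>l * (y \<bullet> y) - y \<bullet> (A *v y)\<close> is
  nonnegative on \<open>W\<close> and vanishes at \<open>v\<close>, so its linear term at
  \<open>v\<close> must vanish in every direction of \<open>W\<close>. The direction tested is the
  residual \<open>l *\<^sub>R v - A *v v\<close>, which lies in \<open>W\<close> by
  invariance.\<close>

lemma rayleigh_maximizer_eigenvector: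
  fixes A :: "complex ^ 'n ^ 'n"
  assumes "hermitian A" and W: "subspace W" and inv: "\<And>w. w \<in> W \<Longrightarrow> A *v w \<in> W"
    and v: "v \<in> W" and max: "\<And>w. w \<in> W \<Longrightarrow> w \<bullet> (A *v w) \<le> l * (w \<bullet> w)"
    and eq: "v \<bullet> (A *v v) = l * (v \<bullet> v)"
  shows "A *v v = l *\<^sub>R v"
proof -
  define w where "w = l *\<^sub>R v - A *v v"
  define c where "c = l * (w \<bullet> w) - w \<bullet> (A *v w)"
  have wW: "w \<in> W"
    unfolding w_def by (intro subspace_diff[OF W] subspace_scale[OF W] v inv)
  \<comment> \<open>The form at \<open>v - t *\<^sub>R w\<close> equals
    \<open>t * (t * c - 2 * (w \<bullet> w))\<close>. Its nonnegativity for all small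
    \<open>t > 0\<close> leaves no room for a nonzero \<open>w\<close>.\<close>
  have "2 * (w \<bullet> w) \<le> t * c" if "t > 0" for t :: real
  proof -
    define y where "y = v - t *\<^sub>R w"
    have "y \<in> W" unfolding y_def by (intro subspace_diff[OF W] subspace_scale[OF W] v wW)
    then have le: "0 \<le> l * (y \<bullet> y) - y \<bullet> (A *v y)" using max by simp
    have lin: "A *v y = A *v v - t *\<^sub>R (A *v w)"
      unfolding y_def by (simp add: matrix_vector_mult_diff_distrib matrix_vector_mult_scaleR_complex)
    have sym: "v \<bullet> (A *v w) = w \<bullet> (A *v v)"
      using hermitian_inner[OF \<open>hermitian A\<close>, of v w] by (simp add: inner_commute)
    have "l * (y \<bullet> y) - y \<bullet> (A *v y) = (l * (v \<bullet> v) - v \<bullet> (A *v v))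
        - 2 * t * (w \<bullet> (l *\<^sub>R v - A *v v)) + t^2 * c"
      unfolding lin unfolding y_def c_def
      by (simp add: inner_diff_left inner_diff_right sym inner_commute[of v w] power2_eq_square algebra_simps)
    also have "\<dots> = t * (t * c - 2 * (w \<bullet> w))"
      using eq by (simp add: w_def[symmetric] power2_eq_square algebra_simps)
    finally show ?thesis using le that by (simp add: zero_le_mult_iff)
  qed
  note * = this
  have "w \<bullet> w \<le> 0"
  proof (rule ccontr)
    assume "\<not> ?thesis"
    then have pos: "w \<bullet> w > 0" by linarith
    have "c > 0" using *[of 1] pos by linarith
    then show False using *[of "(w \<bullet> w) / c"] pos by (simp del: inner_gt_zero_iff)
  qed
  then show ?thesis unfolding w_def by (metis eq_iff_diff_eq_0 inner_eq_zero_iff inner_ge_zero order_antisym)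
qed

text \<open>Induction on the set of labels: each new eigenvector maximizes the Rayleigh quotient on
  the orthogonal complement of the earlier ones. Labels are taken from the index type itself, so
  that \<open>I = UNIV\<close> yields a full eigenbasis.\<close>

lemma hermitian_orthonormal_eigenvectors:
  fixes A :: "complex ^ 'n ^ 'n" and I :: "'n set"
  assumes A: "hermitian A"
  shows "\<exists>(u :: 'n \<Rightarrow> complex ^ 'n) (d :: 'n \<Rightarrow> real).
    (\<forall>i\<in>I. A *v u i = d i *\<^sub>R u i) \<and>
    (\<forall>i\<in>I. \<forall>j\<in>I. (\<Sum>k\<in>UNIV. cnj (u i $ k) * u j $ k) = (if i = j then 1 else 0))"
proof (induction I rule: finite_induct[OF finite])
  case 1
  then show ?case by simp
next
  case (2 m I)
  then obtain u :: "'n \<Rightarrow> complex ^ 'n" and d :: "'n \<Rightarrow> real"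
    where ev: "\<And>i. i \<in> I \<Longrightarrow> A *v u i = d i *\<^sub>R u i"
      and on: "\<And>i j. i \<in> I \<Longrightarrow> j \<in> I \<Longrightarrow>
        (\<Sum>k\<in>UNIV. cnj (u i $ k) * u j $ k) = (if i = j then 1 else 0)"
    by blast
  \<comment> \<open>Including the multiples by \<open>\<i>\<close> turns the real orthogonal
    complement \<open>W\<close> into the complex one. At most \<open>2 * card I\<close> vectors are
    involved, fewer than the real dimension \<open>2 * CARD('n)\<close>, so \<open>W\<close>
    contains a nonzero vector.\<close>
  define B where "B = u ` I \<union> (\<lambda>i. \<i> *s u i) ` I"
  define W where "W = {w. \<forall>b\<in>B. b \<bullet> w = 0}"
  have "card I < CARD('n)"
    using 2(2) by (intro psubset_card_mono) auto
  moreover have "card B \<le> card I + card I"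
    unfolding B_def by (intro order_trans[OF card_Un_le] add_mono card_image_le) auto
  moreover have "dim (span B) \<le> card B"
    unfolding B_def by (auto simp: dim_span intro!: dim_le_card')
  ultimately have "dim (span B) < DIM(complex ^ 'n)" by simp
  then obtain z where z: "z \<noteq> 0" "\<And>y. y \<in> span B \<Longrightarrow> orthogonal z y"
    by (metis orthogonal_to_subspace_exists span_span)
  have zW: "z \<in> W"
    using z(2) span_base by (auto simp: W_def orthogonal_def inner_commute)
  have W: "subspace W"
    by (auto simp: W_def subspace_def inner_add_right)
  have AB: "A *v b \<in> span B" if bB: "b \<in> B" for b
  proof -
    consider i where "i \<in> I" "b = u i" | i where "i \<in> I" "b = \<i> *s u i"
      using bB unfolding B_def by blast
    then have "\<exists>c::real. A *v b = c *\<^sub>R b"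
    proof cases
      case 1
      then show ?thesis using ev by auto
    next
      case 2
      have "A *v b = \<i> *s (A *v u i)"
        using 2 by (simp add: vec_eq_iff matrix_vector_mult_def sum_distrib_left algebra_simps)
      also have "\<dots> = d i *\<^sub>R b"
        using 2 ev by (simp add: vec_eq_iff)
      finally show ?thesis by blast
    qed
    then show ?thesis using bB span_base span_scale by metis
  qed
  have WB: "w \<bullet> b = 0" if "w \<in> W" "b \<in> span B" for w b
    using that(2,1)
    by (induction rule: span_induct_alt) (auto simp: W_def inner_add_right inner_commute)
  \<comment> \<open>Self-adjointness moves \<open>A\<close> onto \<open>b\<close>, and
    \<open>A *v b\<close> stays in \<open>span B\<close>, to which \<open>w\<close> is
    orthogonal.\<close>
  have inv: "A *v w \<in> W" if "w \<in> W" for w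
    unfolding W_def
  proof safe
    fix b assume "b \<in> B"
    have "b \<bullet> (A *v w) = w \<bullet> (A *v b)"
      by (simp add: hermitian_inner[OF A, of b w] inner_commute[of w])
    then show "b \<bullet> (A *v w) = 0" using WB[OF that AB[OF \<open>b \<in> B\<close>]] by simp
  qed
  have "compact (sphere 0 1 \<inter> W)"
    by (intro compact_Int_closed closed_subspace W) auto
  moreover have "(1 / norm z) *\<^sub>R z \<in> sphere 0 1 \<inter> W"
    using z(1) zW subspace_scale[OF W] by auto
  moreover have "continuous_on (sphere 0 1 \<inter> W) (\<lambda>w. w \<bullet> (A *v w))"
    by (intro continuous_intros linear_continuous_on matrix_vector_mul_bounded_linear)
  ultimately obtain v where v: "v \<in> sphere 0 1 \<inter> W"
      and max: "\<And>w. w \<in> sphere 0 1 \<inter> W \<Longrightarrow> w \<bullet> (A *v w) \<le> v \<bullet> (A *v v)"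
    using continuous_attains_sup[of "sphere 0 1 \<inter> W" "\<lambda>w. w \<bullet> (A *v w)"] by blast
  define l where "l = v \<bullet> (A *v v)"
  have vv: "v \<bullet> v = 1" using v by (simp add: norm_eq_1)
  have Av: "A *v v = l *\<^sub>R v"
  proof (rule rayleigh_maximizer_eigenvector[OF A W inv])
    show "w \<bullet> (A *v w) \<le> l * (w \<bullet> w)" if "w \<in> W" for w
    proof (cases "w = 0")
      case False
      define y where "y = (1 / norm w) *\<^sub>R w"
      have "y \<in> sphere 0 1 \<inter> W" using False that subspace_scale[OF W] by (auto simp: y_def)
      moreover have "w = norm w *\<^sub>R y" using False by (simp add: y_def)
      then have "w \<bullet> (A *v w) = (w \<bullet> w) * (y \<bullet> (A *v y))"
        by (metis (no_types, lifting) inner_scaleR_left inner_scaleR_right matrix_vector_mult_scaleR_complex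
            mult.assoc power2_eq_square power2_norm_eq_inner)
      ultimately show ?thesis
        using max[of y] by (simp add: l_def mult.commute[of _ "w \<bullet> w"] mult_left_mono)
    qed auto
  qed (use v vv in \<open>auto simp: l_def\<close>)
  have orth: "(\<Sum>k\<in>UNIV. cnj (u i $ k) * v $ k) = 0" if "i \<in> I" for i
    using v that by (auto simp: complex_eq_iff inner_eq_Re_sum[symmetric] inner_i_eq_Im_sum[symmetric]
        W_def B_def simp del: Re_sum Im_sum)
  have orth': "(\<Sum>k\<in>UNIV. cnj (v $ k) * u i $ k) = 0" if "i \<in> I" for i
    using arg_cong[OF orth[OF that], of cnj] by (simp add: mult.commute)
  have unit: "(\<Sum>k\<in>UNIV. cnj (v $ k) * v $ k) = 1"
  proof -
    have "Im (\<Sum>k\<in>UNIV. cnj (v $ k) * v $ k) = 0" by (simp add: mult.commute)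
    then show ?thesis using vv by (simp add: complex_eq_iff inner_eq_Re_sum)
  qed
  show ?case
  proof (intro exI conjI ballI)
    fix i assume "i \<in> insert m I"
    then show "A *v (u(m := v)) i = (d(m := l)) i *\<^sub>R (u(m := v)) i"
      using 2(2) ev Av by auto
  next
    fix i j assume "i \<in> insert m I" "j \<in> insert m I"
    then show "(\<Sum>k\<in>UNIV. cnj ((u(m := v)) i $ k) * (u(m := v)) j $ k) = (if i = j then 1 else 0)"
      using 2(2) on orth orth' unit by auto
  qed
qed

lemma real_diag_mult: "(A ** real_diag d) $ i $ j = A $ i $ j * of_real (d j)"
  by (simp add: matrix_matrix_mult_def real_diag_def if_distrib cong: if_cong)

lemma real_diag_mult_left: "(real_diag d ** A) $ i $ j = of_real (d i) * A $ i $ j"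
  by (simp add: matrix_matrix_mult_def real_diag_def if_distrib if_distribR cong: if_cong)

theorem hermitian_diagonalizable:
  fixes A :: "complex ^ 'n ^ 'n"
  assumes "hermitian A"
  obtains U d where "unitary U" "A = U ** real_diag d ** conj_transpose U"
proof -
  obtain u :: "'n \<Rightarrow> complex ^ 'n" and d
    where ev: "\<And>i. A *v u i = d i *\<^sub>R u i"
      and on: "\<And>i j. (\<Sum>k\<in>UNIV. cnj (u i $ k) * u j $ k) = (if i = j then 1 else 0)"
    using hermitian_orthonormal_eigenvectors[OF assms, of UNIV] by auto
  define U :: "complex ^ 'n ^ 'n" where "U = (\<chi> i j. u j $ i)"
  have 1: "conj_transpose U ** U = mat 1"
    using on by (simp add: vec_eq_iff matrix_matrix_mult_def mat_def U_def)
  then have 2: "U ** conj_transpose U = mat 1"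
    using matrix_left_right_inverse by blast
  have "(A ** U) $ i $ j = (U ** real_diag d) $ i $ j" for i j
    using arg_cong[OF ev[of j], of "\<lambda>v. v $ i"]
    unfolding real_diag_mult
    by (simp add: matrix_vector_mult_def matrix_matrix_mult_def U_def vector_scaleR_component
        scaleR_conv_of_real[where 'a = complex] mult.commute)
  then have "A ** U = U ** real_diag d" by (simp add: vec_eq_iff)
  then have "A = U ** real_diag d ** conj_transpose U"
    by (metis 2 matrix_mul_assoc matrix_mul_rid)
  then show ?thesis using that 1 2 by (simp add: unitary_def)
qed

section \<open>Spectral calculus and traces\<close>

text \<open>The point is uniqueness. For two diagonalizations of \<open>A\<close> the matrix
  \<open>W = conj_transpose V ** U\<close> intertwines the two diagonals, so an entry of
  \<open>W\<close> can be nonzero only where the eigenvalues \<open>d j\<close> and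
  \<open>e i\<close> agree. Hence \<open>W\<close> also intertwines their images under
  \<open>f\<close>.\<close>

lemma spectral_fun_eq:
  assumes U: "unitary U" and A: "A = U ** real_diag d ** conj_transpose U"
  shows "spectral_fun f A = U ** real_diag (f \<circ> d) ** conj_transpose U"
  unfolding spectral_fun_def
proof (rule the_equality)
  show "\<exists>U' d'. unitary U' \<and> A = U' ** real_diag d' ** conj_transpose U' \<and>
      U ** real_diag (f \<circ> d) ** conj_transpose U = U' ** real_diag (f \<circ> d') ** conj_transpose U'"
    using assms by blast
next
  fix B
  assume "\<exists>V e. unitary V \<and> A = V ** real_diag e ** conj_transpose V \<and>
      B = V ** real_diag (f \<circ> e) ** conj_transpose V"
  then obtain V e where V: "unitary V" and A': "A = V ** real_diag e ** conj_transpose V"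
    and B: "B = V ** real_diag (f \<circ> e) ** conj_transpose V" by blast
  define W where "W = conj_transpose V ** U"
  have VW: "V ** W = U" and WU: "W ** conj_transpose U = conj_transpose V"
    using U V unfolding W_def unitary_def
    by (metis matrix_mul_assoc matrix_mul_lid) (metis U matrix_mul_assoc matrix_mul_rid unitary_def)
  have "W ** real_diag d = conj_transpose V ** A ** U"
    using U unfolding A W_def unitary_def by (metis matrix_mul_assoc matrix_mul_rid)
  also have "\<dots> = real_diag e ** W"
    using V unfolding A' W_def unitary_def by (metis matrix_mul_assoc matrix_mul_lid)
  finally have "W $ i $ j * of_real (d j) = of_real (e i) * W $ i $ j" for i j
    by (metis real_diag_mult real_diag_mult_left)
  then have "W $ i $ j = 0 \<or> d j = e i" for i j
    by (metis mult.commute mult_cancel_left of_real_eq_iff)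
  then have "(W ** real_diag (f \<circ> d)) $ i $ j = (real_diag (f \<circ> e) ** W) $ i $ j" for i j
    unfolding real_diag_mult real_diag_mult_left by (metis comp_apply mult.commute mult_zero_left)
  then have *: "W ** real_diag (f \<circ> d) = real_diag (f \<circ> e) ** W"
    by (simp add: vec_eq_iff)
  have "U ** real_diag (f \<circ> d) ** conj_transpose U = V ** (W ** real_diag (f \<circ> d)) ** conj_transpose U"
    by (metis VW matrix_mul_assoc)
  also have "\<dots> = B" unfolding * B by (metis WU matrix_mul_assoc)
  finally show "B = U ** real_diag (f \<circ> d) ** conj_transpose U" by simp
qed

abbreviation log0 :: "real \<Rightarrow> real" where
  "log0 x \<equiv> if x = 0 then 0 else ln x"

text \<open>This is the squared modulus of the inner product of column \<open>i\<close> of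
  \<open>U\<close> with column \<open>j\<close> of \<open>V\<close>. For unitary matrices these
  weights are doubly stochastic: \<open>sum_overlap\<close> treats the rows, and
  \<open>overlap_commute\<close> transfers this to the columns.\<close>

definition overlap :: "complex ^ 'n ^ 'n \<Rightarrow> complex ^ 'n ^ 'n \<Rightarrow> 'n \<Rightarrow> 'n \<Rightarrow> real" where
  "overlap U V i j = (cmod ((conj_transpose U ** V) $ i $ j))\<^sup>2"

lemma overlap_nonneg: "0 \<le> overlap U V i j"
  by (simp add: overlap_def)

lemma overlap_commute: "overlap U V i j = overlap V U j i"
proof -
  have "(conj_transpose U ** V) $ i $ j = cnj ((conj_transpose V ** U) $ j $ i)"
    by (metis conj_transpose_conj_transpose conj_transpose_mult conj_transpose_nth)
  then show ?thesis by (simp add: overlap_def)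
qed

lemma sum_overlap:
  assumes "unitary U" "unitary V"
  shows "(\<Sum>j\<in>UNIV. overlap U V i j) = 1"
proof -
  define W where "W = conj_transpose U ** V"
  have "W ** conj_transpose W = mat 1"
    using assms unfolding W_def unitary_def conj_transpose_mult conj_transpose_conj_transpose
    by (metis matrix_mul_assoc matrix_mul_rid)
  then have "(W ** conj_transpose W) $ i $ i = 1" by (simp add: mat_def)
  then have "of_real (\<Sum>j\<in>UNIV. (cmod (W $ i $ j))\<^sup>2) = (1::complex)"
    by (simp add: matrix_matrix_mult_def complex_norm_square del: of_real_power)
  then show ?thesis unfolding overlap_def W_def by (metis of_real_eq_1_iff)
qed

lemma overlap_self: "unitary U \<Longrightarrow> overlap U U i j = (if i = j then 1 else 0)"
  by (simp add: overlap_def unitary_def mat_def)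

text \<open>Cyclicity of the trace gathers the unitaries into
  \<open>W = conj_transpose U ** V\<close>. The products of entries of \<open>W\<close> and
  \<open>conj_transpose W\<close> left on the diagonal are the squared moduli of the entries of
  \<open>W\<close>.\<close>

lemma trace_spectral_mult:
  fixes U V :: "complex ^ 'n ^ 'n"
  shows "trace ((U ** real_diag f ** conj_transpose U) ** (V ** real_diag g ** conj_transpose V))
    = of_real (\<Sum>i\<in>UNIV. \<Sum>j\<in>UNIV. overlap U V i j * (f i * g j))"
proof -
  define W where "W = conj_transpose U ** V"
  have "trace ((U ** real_diag f ** conj_transpose U) ** (V ** real_diag g ** conj_transpose V))
      = trace (U ** (real_diag f ** conj_transpose U ** V ** real_diag g ** conj_transpose V))"
    by (simp add: matrix_mul_assoc)
  also have "\<dots> = trace ((real_diag f ** conj_transpose U ** V ** real_diag g ** conj_transpose V) ** U)"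
    by (rule trace_mul_sym)
  also have "\<dots> = trace ((real_diag f ** W) ** (real_diag g ** conj_transpose W))"
    by (simp add: W_def conj_transpose_mult matrix_mul_assoc)
  also have "\<dots> = (\<Sum>i\<in>UNIV. \<Sum>j\<in>UNIV. of_real (overlap U V i j * (f i * g j)))"
  proof -
    have "(X ** Y) $ i $ i = (\<Sum>j\<in>UNIV. X $ i $ j * Y $ j $ i)" for X Y :: "complex ^ 'n ^ 'n" and i
      by (simp add: matrix_matrix_mult_def)
    then show ?thesis
      unfolding trace_def overlap_def W_def[symmetric]
      by (simp add: real_diag_mult_left complex_norm_square mult_ac del: of_real_power)
  qed
  finally show ?thesis by simp
qed

lemma trace_spectral_mult_self:
  assumes "unitary U"
  shows "trace ((U ** real_diag f ** conj_transpose U) ** (U ** real_diag g ** conj_transpose U))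
    = of_real (\<Sum>i\<in>UNIV. f i * g i)"
  unfolding trace_spectral_mult overlap_self[OF assms]
  by (simp add: if_distrib if_distribR cong: if_cong)

lemma trace_spectral:
  assumes "unitary U"
  shows "trace (U ** real_diag f ** conj_transpose U) = of_real (\<Sum>i\<in>UNIV. f i)"
proof -
  have "trace (U ** (real_diag f ** conj_transpose U)) = trace ((real_diag f ** conj_transpose U) ** U)"
    by (rule trace_mul_sym)
  also have "\<dots> = trace (real_diag f)"
    using assms by (metis matrix_mul_assoc matrix_mul_rid unitary_def)
  finally show ?thesis by (simp add: matrix_mul_assoc trace_def real_diag_def)
qed

text \<open>The norm of nested vectors is the Frobenius norm, and for Hermitian \<open>A\<close> the
  product of the entries at (i, j) and (j, i) is a squared modulus.\<close>

lemma trace_hermitian_square: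
  fixes A :: "complex ^ 'n ^ 'n"
  assumes "hermitian A"
  shows "Re (trace (A ** A)) = (norm A)\<^sup>2"
proof -
  have "A $ i $ j * A $ j $ i = of_real (A $ i $ j \<bullet> A $ i $ j)" for i j
    unfolding hermitian_cnj[OF assms, of i j, symmetric] power2_norm_eq_inner[symmetric]
    by (simp add: complex_norm_square del: of_real_power)
  then have "Re (trace (A ** A)) = (\<Sum>i\<in>UNIV. \<Sum>j\<in>UNIV. A $ i $ j \<bullet> A $ i $ j)"
    by (simp add: trace_def matrix_matrix_mult_def)
  then show ?thesis by (simp add: power2_norm_eq_inner inner_vec_def)
qed

section \<open>Eigenvectors, positivity and kernels of spectral decompositions\<close>

lemma spectral_eigenvector:
  assumes "unitary U" and A: "A = U ** real_diag d ** conj_transpose U"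
  shows "A *v column i U = d i *\<^sub>R column i U"
proof -
  have "A ** U = U ** real_diag d"
    using assms(1) unfolding A unitary_def by (metis matrix_mul_assoc matrix_mul_rid)
  then have "(A ** U) $ k $ i = U $ k $ i * of_real (d i)" for k
    by (simp add: real_diag_mult)
  then show ?thesis
    by (simp add: vec_eq_iff column_def matrix_vector_mult_def matrix_matrix_mult_def
        scaleR_conv_of_real[where 'a = complex] mult.commute)
qed

lemma unitary_column_norm:
  assumes "unitary U"
  shows "column i U \<bullet> column i U = 1"
proof -
  have "(conj_transpose U ** U) $ i $ i = 1" using assms by (simp add: unitary_def mat_def)
  then show ?thesis by (simp add: inner_eq_Re_sum column_def matrix_matrix_mult_def)
qed

lemma psd_diagonalizable:
  fixes A :: "complex ^ 'n ^ 'n"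
  assumes "psd A"
  obtains U d where "unitary U" "A = U ** real_diag d ** conj_transpose U" "\<And>i. 0 \<le> d i"
proof -
  obtain U d where U: "unitary U" and A: "A = U ** real_diag d ** conj_transpose U"
    using assms hermitian_diagonalizable psd_def by blast
  have "0 \<le> column i U \<bullet> (A *v column i U)" for i
    using assms psd_def by blast
  then have "0 \<le> d i" for i
    by (simp add: spectral_eigenvector[OF U A] unitary_column_norm[OF U])
  then show ?thesis using that U A by blast
qed

lemma spectral_psd:
  assumes "\<And>i. 0 \<le> d i"
  shows "psd (U ** real_diag d ** conj_transpose U)"
  unfolding psd_def
proof (intro conjI allI)
  have "conj_transpose (real_diag d) = real_diag d" by (simp add: vec_eq_iff real_diag_def)
  then show "hermitian (U ** real_diag d ** conj_transpose U)"
    by (simp add: hermitian_def conj_transpose_mult matrix_mul_assoc)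
next
  fix v
  define w where "w = conj_transpose U *v v"
  have "(U ** real_diag d ** conj_transpose U) *v v = U *v (real_diag d *v w)"
    by (simp add: w_def matrix_vector_mul_assoc matrix_mul_assoc)
  then have "v \<bullet> ((U ** real_diag d ** conj_transpose U) *v v) = w \<bullet> (real_diag d *v w)"
    by (simp add: inner_matrix_vector_mult w_def)
  also have "real_diag d *v w = (\<chi> i. d i *\<^sub>R w $ i)"
    by (simp add: vec_eq_iff matrix_vector_mult_def real_diag_def if_distrib if_distribR
        scaleR_conv_of_real cong: if_cong)
  also have "w \<bullet> (\<chi> i. d i *\<^sub>R w $ i) = (\<Sum>i\<in>UNIV. d i * (w $ i \<bullet> w $ i))"
    by (simp add: inner_vec_def)
  also have "\<dots> \<ge> 0" by (intro sum_nonneg mult_nonneg_nonneg assms) simp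
  finally show "0 \<le> v \<bullet> ((U ** real_diag d ** conj_transpose U) *v v)" .
qed

lemma matrix_ker_spectral:
  assumes "unitary U" and "\<And>i. d i \<noteq> 0"
  shows "matrix_ker (U ** real_diag d ** conj_transpose U) = {0}"
proof -
  have "v = 0" if "(U ** real_diag d ** conj_transpose U) *v v = 0" for v
  proof -
    let ?B = "U ** real_diag (\<lambda>i. 1 / d i) ** conj_transpose U"
    have "real_diag (\<lambda>i. 1 / d i) ** real_diag d = mat 1"
      using assms(2) by (simp add: vec_eq_iff real_diag_mult) (simp add: real_diag_def mat_def)
    then have "?B ** (U ** real_diag d ** conj_transpose U) = mat 1"
      using assms(1) unfolding unitary_def by (metis matrix_mul_assoc matrix_mul_rid)
    then show ?thesis using that
      by (metis matrix_vector_mul_assoc matrix_vector_mul_lid matrix_vector_mult_0_right)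
  qed
  then show ?thesis by (auto simp: matrix_ker_def)
qed

section \<open>Klein's inequality\<close>

text \<open>The entropy term dominates \<open>(sqrt a - sqrt b)\<^sup>2\<close>, and multiplying by
  \<open>(sqrt a + sqrt b)\<^sup>2\<close>, which is at most \<open>2 * T\<close>, turns this into
  \<open>(a - b)\<^sup>2\<close>. The last hypothesis excludes \<open>b = 0 < a\<close>, where the
  default \<open>log0 0 = 0\<close> would hide an infinite value.\<close>

lemma relative_entropy_scalar_bound:
  fixes a b T :: real
  assumes "0 \<le> a" "0 \<le> b" "a + b \<le> T" "b = 0 \<Longrightarrow> a = 0"
  shows "(a - b)\<^sup>2 \<le> 2 * T * (a * (log0 a - log0 b) - a + b)"
proof (cases "a = 0")
  case True
  have "b * b \<le> (2 * T) * b" using assms by (intro mult_right_mono) auto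
  then show ?thesis using True by (simp add: power2_eq_square)
next
  case False
  then have a: "a > 0" and b: "b > 0" using assms by fastforce+
  \<comment> \<open>Applying the bound \<open>ln x \<le> x - 1\<close> at the square root, rather
    than at \<open>b / a\<close> itself, is what produces a square instead of mere
    nonnegativity.\<close>
  have "ln (sqrt (b / a)) \<le> sqrt (b / a) - 1"
    using a b by (intro ln_le_minus_one) simp
  then have "(ln b - ln a) / 2 \<le> sqrt (b / a) - 1"
    using a b by (simp add: ln_sqrt ln_div)
  then have "a * (ln b - ln a) \<le> a * (2 * (sqrt (b / a) - 1))"
    using a by (intro mult_left_mono) auto
  also have "\<dots> = 2 * (sqrt a * sqrt b) - 2 * a"
    using a by (simp add: real_sqrt_divide field_simps)
  finally have "(sqrt a - sqrt b)\<^sup>2 \<le> a * (ln a - ln b) - a + b"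
    using a b by (simp add: power2_eq_square algebra_simps)
  then have 1: "2 * T * (sqrt a - sqrt b)\<^sup>2 \<le> 2 * T * (a * (ln a - ln b) - a + b)"
    using assms by (intro mult_left_mono) auto
  have "(sqrt a + sqrt b)\<^sup>2 + (sqrt a - sqrt b)\<^sup>2 = 2 * (a + b)"
    using a b by (simp add: power2_eq_square algebra_simps)
  then have "(sqrt a + sqrt b)\<^sup>2 \<le> 2 * T" using assms(3) by (smt (verit) zero_le_power2)
  then have "(sqrt a + sqrt b)\<^sup>2 * (sqrt a - sqrt b)\<^sup>2 \<le> 2 * T * (sqrt a - sqrt b)\<^sup>2"
    by (intro mult_right_mono) auto
  also have "(sqrt a + sqrt b)\<^sup>2 * (sqrt a - sqrt b)\<^sup>2 = (a - b)\<^sup>2"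
  proof -
    have "(sqrt a + sqrt b) * (sqrt a - sqrt b) = a - b"
      using a b by (simp add: algebra_simps)
    then show ?thesis by (metis power_mult_distrib)
  qed
  finally show ?thesis using 1 a b by simp
qed

lemma matrix_mult_diff_right: "A ** (B - C) = A ** B - A ** (C :: complex ^ 'n ^ 'm)"
  by (simp add: vec_eq_iff matrix_matrix_mult_def algebra_simps sum_subtractf)

lemma matrix_mult_diff_left: "(A - B) ** C = A ** C - B ** (C :: complex ^ 'n ^ 'm)"
  by (simp add: vec_eq_iff matrix_matrix_mult_def algebra_simps sum_subtractf)

text \<open>Both sides expand over the doubly stochastic weights \<open>\<bar>\<langle>u\<^sub>i, v\<^sub>j\<rangle>\<bar>\<^sup>2\<close> of the two eigenbases, which
  reduces the claim to the scalar bound.\<close>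

lemma relative_entropy_bound:
  fixes A B :: "complex ^ 'n ^ 'n"
  assumes "psd A" "psd B"
  shows "ereal ((norm (A - B))\<^sup>2 / (2 * (Re (trace A) + Re (trace B)) + 1)) \<le> relative_entropy A B"
proof (cases "matrix_ker B \<subseteq> matrix_ker A")
  case False
  then show ?thesis by (simp add: relative_entropy_def)
next
  case True
  obtain U a where U: "unitary U" and A: "A = U ** real_diag a ** conj_transpose U" and a: "\<And>i. 0 \<le> a i"
    using psd_diagonalizable[OF assms(1)] by blast
  obtain V b where V: "unitary V" and B: "B = V ** real_diag b ** conj_transpose V" and b: "\<And>i. 0 \<le> b i"
    using psd_diagonalizable[OF assms(2)] by blast
  let ?w = "overlap U V"
  define T where "T = Re (trace A) + Re (trace B)"
  define E where "E = Re (trace (A ** (matrix_log A - matrix_log B - mat 1) + B))"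
  have logA: "matrix_log A = U ** real_diag (log0 \<circ> a) ** conj_transpose U"
    unfolding matrix_log_def by (rule spectral_fun_eq[OF U A])
  have logB: "matrix_log B = V ** real_diag (log0 \<circ> b) ** conj_transpose V"
    unfolding matrix_log_def by (rule spectral_fun_eq[OF V B])
  \<comment> \<open>Double stochasticity rewrites sums over one spectrum as double sums with the
    common weights \<open>?w\<close>, so that all traces can be compared term by term.\<close>
  have row: "(\<Sum>i\<in>UNIV. f i) = (\<Sum>i\<in>UNIV. \<Sum>j\<in>UNIV. ?w i j * f i)" for f
    by (simp add: sum_overlap[OF U V] sum_distrib_right[symmetric])
  have col: "(\<Sum>j\<in>UNIV. f j) = (\<Sum>i\<in>UNIV. \<Sum>j\<in>UNIV. ?w i j * f j)" for f
    by (subst sum.swap) (simp add: overlap_commute[of U V] sum_overlap[OF V U] sum_distrib_right[symmetric])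
  have trA: "Re (trace A) = (\<Sum>i\<in>UNIV. a i)" unfolding A trace_spectral[OF U] by simp
  have trB: "Re (trace B) = (\<Sum>i\<in>UNIV. b i)" unfolding B trace_spectral[OF V] by simp
  have "E = Re (trace (A ** matrix_log A)) - Re (trace (A ** matrix_log B)) - Re (trace A) + Re (trace B)"
    by (simp add: E_def trace_add trace_sub matrix_mult_diff_right)
  also have "Re (trace (A ** matrix_log A)) = (\<Sum>i\<in>UNIV. a i * log0 (a i))"
    unfolding logA by (subst A, unfold trace_spectral_mult_self[OF U]) simp
  also have "Re (trace (A ** matrix_log B)) = (\<Sum>i\<in>UNIV. \<Sum>j\<in>UNIV. ?w i j * (a i * log0 (b j)))"
    unfolding logB by (subst A, unfold trace_spectral_mult) simp
  finally have E: "E = (\<Sum>i\<in>UNIV. \<Sum>j\<in>UNIV. ?w i j * (a i * (log0 (a i) - log0 (b j)) - a i + b j))"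
    unfolding trA trB row[of "\<lambda>i. a i * log0 (a i)"] row[of a] col[of b]
      sum_subtractf[symmetric] sum.distrib[symmetric]
    by (simp add: algebra_simps)
  have "hermitian (A - B)"
    using assms by (simp add: psd_def hermitian_def conj_transpose_diff)
  then have "(norm (A - B))\<^sup>2 = Re (trace ((A - B) ** (A - B)))"
    by (simp add: trace_hermitian_square)
  also have "\<dots> = Re (trace (A ** A)) - 2 * Re (trace (A ** B)) + Re (trace (B ** B))"
    by (simp add: trace_sub matrix_mult_diff_right matrix_mult_diff_left trace_mul_sym[of B A])
  also have "Re (trace (A ** A)) = (\<Sum>i\<in>UNIV. a i * a i)"
    unfolding A trace_spectral_mult_self[OF U] by simp
  also have "Re (trace (B ** B)) = (\<Sum>i\<in>UNIV. b i * b i)"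
    unfolding B trace_spectral_mult_self[OF V] by simp
  also have "2 * Re (trace (A ** B)) = (\<Sum>i\<in>UNIV. \<Sum>j\<in>UNIV. ?w i j * (2 * a i * b j))"
    unfolding A B trace_spectral_mult by (simp add: sum_distrib_left mult_ac)
  finally have N: "(norm (A - B))\<^sup>2 = (\<Sum>i\<in>UNIV. \<Sum>j\<in>UNIV. ?w i j * (a i - b j)\<^sup>2)"
    unfolding row[of "\<lambda>i. a i * a i"] col[of "\<lambda>i. b i * b i"]
      sum_subtractf[symmetric] sum.distrib[symmetric]
    by (simp add: algebra_simps power2_eq_square)
  have T: "a i + b j \<le> T" for i j
    unfolding T_def trA trB by (intro add_mono member_le_sum) (auto simp: a b)
  then have "0 \<le> T" using a b by (meson add_nonneg_nonneg order_trans)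
  \<comment> \<open>The kernel inclusion in coordinates: if \<open>b j = 0\<close>, then column
    \<open>j\<close> of \<open>V\<close> lies in the kernel of \<open>A\<close>, which makes
    \<open>a i\<close> times the corresponding entry of \<open>conj_transpose U ** V\<close> vanish.
    Wherever the weight is nonzero, this is the last hypothesis of the scalar bound.\<close>
  have ker: "?w i j = 0 \<or> a i = 0" if "b j = 0" for i j
  proof -
    have "B *v column j V = 0" using spectral_eigenvector[OF V B, of j] that by simp
    then have 0: "A *v column j V = 0" using True by (auto simp: matrix_ker_def)
    have "conj_transpose U ** A ** V = real_diag a ** (conj_transpose U ** V)"
      using U unfolding A unitary_def by (metis matrix_mul_assoc matrix_mul_lid)
    moreover have "(conj_transpose U ** A ** V) $ i $ j = 0"
    proof -
      have "(A ** V) $ k $ j = 0" for k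
        using arg_cong[OF 0, of "\<lambda>v. v $ k"]
        by (simp add: matrix_vector_mult_def matrix_matrix_mult_def column_def)
      then show ?thesis
        unfolding matrix_mul_assoc[symmetric] by (subst matrix_matrix_mult_def) simp
    qed
    ultimately show ?thesis by (auto simp: real_diag_mult_left overlap_def)
  qed
  have bound: "?w i j * (a i - b j)\<^sup>2 \<le> (2 * T) * (?w i j * (a i * (log0 (a i) - log0 (b j)) - a i + b j))" for i j
  proof (cases "?w i j = 0")
    case False
    then have "(a i - b j)\<^sup>2 \<le> 2 * T * (a i * (log0 (a i) - log0 (b j)) - a i + b j)"
      using ker by (intro relative_entropy_scalar_bound a b T) auto
    from mult_left_mono[OF this overlap_nonneg[of U V i j]] show ?thesis
      by (simp only: mult.left_commute[of "2 * T"])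
  qed simp
  have N_le: "(norm (A - B))\<^sup>2 \<le> (2 * T) * E"
    unfolding N E sum_distrib_left by (intro sum_mono bound)
  \<comment> \<open>Needed to enlarge \<open>2 * T\<close> to \<open>2 * T + 1\<close>, a
    denominator that stays positive even when both traces vanish. The scalar bound is used with
    \<open>T + 1\<close> so that the factor to be cancelled is strictly positive.\<close>
  have "0 \<le> E"
  proof -
    have "0 \<le> ?w i j * (a i * (log0 (a i) - log0 (b j)) - a i + b j)" for i j
    proof (cases "?w i j = 0")
      case False
      then have "(a i - b j)\<^sup>2 \<le> 2 * (T + 1) * (a i * (log0 (a i) - log0 (b j)) - a i + b j)"
        using ker T[of i j] by (intro relative_entropy_scalar_bound a b) auto
      then have "0 \<le> 2 * (T + 1) * (a i * (log0 (a i) - log0 (b j)) - a i + b j)"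
        by (meson order_trans zero_le_power2)
      then have "0 \<le> a i * (log0 (a i) - log0 (b j)) - a i + b j"
        using \<open>0 \<le> T\<close> by (metis add_pos_nonneg mult.commute mult_pos_pos not_less zero_le_mult_iff zero_less_numeral zero_less_one add.commute)
      then show ?thesis by (intro mult_nonneg_nonneg overlap_nonneg)
    qed simp
    then show ?thesis unfolding E by (intro sum_nonneg) auto
  qed
  then have "(norm (A - B))\<^sup>2 \<le> E * (2 * T + 1)" using N_le by (simp add: algebra_simps)
  then have "(norm (A - B))\<^sup>2 / (2 * T + 1) \<le> E"
    using \<open>0 \<le> T\<close> by (simp add: pos_divide_le_eq)
  then show ?thesis using True by (simp add: relative_entropy_def E_def T_def)
qed

section \<open>Nonnegativity of the relative entropy and affine minorants of the entropy\<close>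

lemma psd_trace_nonneg:
  assumes "psd A"
  shows "0 \<le> Re (trace A)"
  using psd_diagonalizable[OF assms] by (metis Re_complex_of_real sum_nonneg trace_spectral)

lemma relative_entropy_nonneg:
  assumes "psd A" "psd B"
  shows "0 \<le> relative_entropy A B"
proof -
  have "ereal 0 \<le> ereal ((norm (A - B))\<^sup>2 / (2 * (Re (trace A) + Re (trace B)) + 1))"
    using psd_trace_nonneg[OF assms(1)] psd_trace_nonneg[OF assms(2)] by simp
  then show ?thesis using relative_entropy_bound[OF assms] unfolding zero_ereal_def by (rule order_trans)
qed

lemma relative_entropy_self: "relative_entropy A A = 0"
proof -
  have "A ** (matrix_log A - matrix_log A - mat 1) + A = 0"
    unfolding matrix_mult_diff_right by simp
  then show ?thesis by (simp add: relative_entropy_def zero_ereal_def trace_def)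
qed

text \<open>A rearrangement of the nonnegativity of \<open>relative_entropy A G\<close>. The trivial
  kernel of \<open>G\<close> makes that relative entropy finite for every \<open>A\<close>, and the
  resulting lower bound is affine in \<open>A\<close>.\<close>

lemma von_neumann_entropy_ge:
  assumes "psd A" "psd G" "matrix_ker G = {0}"
  shows "Re (trace (A ** matrix_log G)) - Re (trace G) \<le> von_neumann_entropy A"
proof -
  have "matrix_ker G \<subseteq> matrix_ker A" using assms(3) by (simp add: matrix_ker_def)
  then show ?thesis
    using relative_entropy_nonneg[OF assms(1,2)]
    by (simp add: relative_entropy_def von_neumann_entropy_def trace_add trace_sub matrix_mult_diff_right)
qed

text \<open>The affine minorant is Klein's inequality at \<open>A\<close> with its zero eigenvalues raised to a small
  \<open>\<delta>\<close>; as a supremum of such functions the entropy is lower semicontinuous.\<close>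

lemma von_neumann_entropy_affine_minorant:
  fixes A :: "complex ^ 'n ^ 'n"
  assumes "psd A" "\<eta> > 0"
  obtains L c where "\<And>B. psd B \<Longrightarrow> Re (trace (B ** L)) - c \<le> von_neumann_entropy B"
    "von_neumann_entropy A - \<eta> \<le> Re (trace (A ** L)) - c"
proof -
  obtain U d where U: "unitary U" and A: "A = U ** real_diag d ** conj_transpose U" and d: "\<And>i. 0 \<le> d i"
    using psd_diagonalizable[OF assms(1)] by blast
  \<comment> \<open>Raising at most \<open>CARD('n)\<close> zero eigenvalues to \<delta> costs at
    most \<eta> in trace. It leaves the trace of \<open>A ** matrix_log G\<close> equal to that of
    \<open>A ** matrix_log A\<close>, since the logarithm changes only on the kernel of
    \<open>A\<close>.\<close>
  define \<delta> where "\<delta> = \<eta> / real CARD('n)"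
  have \<delta>: "\<delta> > 0" using assms(2) by (simp add: \<delta>_def)
  define g where "g i = (if d i = 0 then \<delta> else d i)" for i
  define G where "G = U ** real_diag g ** conj_transpose U"
  have "g i > 0" for i using d[of i] \<delta> by (simp add: g_def less_le)
  then have G: "psd G" "matrix_ker G = {0}"
    unfolding G_def by (auto intro!: spectral_psd matrix_ker_spectral[OF U] simp: less_imp_le less_imp_neq[symmetric])
  have "matrix_log A = U ** real_diag (log0 \<circ> d) ** conj_transpose U"
    unfolding matrix_log_def by (rule spectral_fun_eq[OF U A])
  then have 1: "Re (trace (A ** matrix_log A)) = (\<Sum>i\<in>UNIV. d i * log0 (d i))"
    by (subst A) (simp add: trace_spectral_mult_self[OF U])
  have "matrix_log G = U ** real_diag (log0 \<circ> g) ** conj_transpose U"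
    unfolding matrix_log_def by (rule spectral_fun_eq[OF U G_def])
  then have "Re (trace (A ** matrix_log G)) = (\<Sum>i\<in>UNIV. d i * log0 (g i))"
    by (subst A) (simp add: trace_spectral_mult_self[OF U])
  also have "\<dots> = (\<Sum>i\<in>UNIV. d i * log0 (d i))" by (intro sum.cong) (auto simp: g_def)
  finally have 2: "Re (trace (A ** matrix_log G)) = (\<Sum>i\<in>UNIV. d i * log0 (d i))" .
  have "Re (trace G) = (\<Sum>i\<in>UNIV. g i)" unfolding G_def trace_spectral[OF U] by simp
  also have "\<dots> \<le> (\<Sum>i\<in>UNIV. d i + \<delta>)" using \<delta> d by (intro sum_mono) (auto simp: g_def)
  also have "\<dots> = Re (trace A) + \<eta>" unfolding A trace_spectral[OF U] by (simp add: sum.distrib \<delta>_def)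
  finally have "Re (trace G) \<le> Re (trace A) + \<eta>" .
  then have "von_neumann_entropy A - \<eta> \<le> Re (trace (A ** matrix_log G)) - Re (trace G)"
    by (simp add: von_neumann_entropy_def matrix_mult_diff_right trace_sub 1 2)
  then show ?thesis using that von_neumann_entropy_ge[OF _ G] by blast
qed

section \<open>Partial traces\<close>

lemma sum_UNIV_prod: "(\<Sum>p\<in>UNIV. f p) = (\<Sum>i\<in>UNIV. \<Sum>k\<in>UNIV. f (i, k))"
  for f :: "'a::finite \<times> 'b::finite \<Rightarrow> 'c::comm_monoid_add"
  by (simp add: sum.cartesian_product flip: UNIV_Times_UNIV)

lemma trace_partial_trace_2: "trace (partial_trace_2 \<Gamma>) = trace \<Gamma>"
  by (simp add: trace_def partial_trace_2_def sum_UNIV_prod)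

text \<open>The quadratic form of the partial trace at \<open>v\<close> is the sum over
  \<open>k\<close> of the form of \<Gamma> at \<open>w k\<close>, the tensor product of
  \<open>v\<close> with the basis vector \<open>k\<close> of the second factor.\<close>

lemma psd_partial_trace_2:
  fixes \<Gamma> :: "complex ^ ('a::finite \<times> 'b::finite) ^ ('a \<times> 'b)"
  assumes "psd \<Gamma>"
  shows "psd (partial_trace_2 \<Gamma>)"
  unfolding psd_def
proof (intro conjI allI)
  have "hermitian \<Gamma>" using assms by (simp add: psd_def)
  then show "hermitian (partial_trace_2 \<Gamma>)"
    unfolding hermitian_def[of "partial_trace_2 \<Gamma>"]
    by (simp add: vec_eq_iff partial_trace_2_def hermitian_cnj)
  fix v :: "complex ^ 'a"
  define w :: "'b \<Rightarrow> complex ^ ('a \<times> 'b)" where "w k = (\<chi> p. if snd p = k then v $ fst p else 0)" for k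
  have *: "w k \<bullet> (\<Gamma> *v w k) = Re (\<Sum>i\<in>UNIV. \<Sum>j\<in>UNIV. cnj (v $ i) * (\<Gamma> $ (i, k) $ (j, k) * v $ j))" for k
    by (simp add: inner_eq_Re_sum w_def matrix_vector_mult_def sum_UNIV_prod if_distrib if_distribR
        sum_distrib_left del: Re_sum cong: if_cong)
  have "v \<bullet> (partial_trace_2 \<Gamma> *v v)
      = Re (\<Sum>i\<in>UNIV. \<Sum>j\<in>UNIV. \<Sum>k\<in>UNIV. cnj (v $ i) * (\<Gamma> $ (i, k) $ (j, k) * v $ j))"
    by (simp add: inner_eq_Re_sum partial_trace_2_def matrix_vector_mult_def
        sum_distrib_left sum_distrib_right del: Re_sum)
  also have "\<dots> = Re (\<Sum>k\<in>UNIV. \<Sum>i\<in>UNIV. \<Sum>j\<in>UNIV. cnj (v $ i) * (\<Gamma> $ (i, k) $ (j, k) * v $ j))"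
    by (simp only: sum.swap[where B = "UNIV :: 'b set"])
  also have "\<dots> = (\<Sum>k\<in>UNIV. w k \<bullet> (\<Gamma> *v w k))" unfolding * by simp
  also have "\<dots> \<ge> 0" using assms by (intro sum_nonneg) (simp add: psd_def)
  finally show "0 \<le> v \<bullet> (partial_trace_2 \<Gamma> *v v)" .
qed

text \<open>As for the other factor, now with \<open>w i\<close> the tensor product of the basis
  vector \<open>i\<close> with \<open>v\<close>.\<close>

lemma psd_partial_trace_1:
  fixes \<Gamma> :: "complex ^ ('a::finite \<times> 'b::finite) ^ ('a \<times> 'b)"
  assumes "psd \<Gamma>"
  shows "psd (partial_trace_1 \<Gamma>)"
  unfolding psd_def
proof (intro conjI allI)
  have "hermitian \<Gamma>" using assms by (simp add: psd_def)
  then show "hermitian (partial_trace_1 \<Gamma>)"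
    unfolding hermitian_def[of "partial_trace_1 \<Gamma>"]
    by (simp add: vec_eq_iff partial_trace_1_def hermitian_cnj)
  fix v :: "complex ^ 'b"
  define w :: "'a \<Rightarrow> complex ^ ('a \<times> 'b)" where "w i = (\<chi> p. if fst p = i then v $ snd p else 0)" for i
  have *: "w i \<bullet> (\<Gamma> *v w i) = Re (\<Sum>k\<in>UNIV. \<Sum>l\<in>UNIV. cnj (v $ k) * (\<Gamma> $ (i, k) $ (i, l) * v $ l))" for i
    unfolding inner_eq_Re_sum sum_UNIV_prod matrix_vector_mult_def
    by (subst (1 2) sum.swap) (simp add: w_def if_distrib if_distribR sum_distrib_left del: Re_sum cong: if_cong)
  have "v \<bullet> (partial_trace_1 \<Gamma> *v v)
      = Re (\<Sum>k\<in>UNIV. \<Sum>l\<in>UNIV. \<Sum>i\<in>UNIV. cnj (v $ k) * (\<Gamma> $ (i, k) $ (i, l) * v $ l))"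
    by (simp add: inner_eq_Re_sum partial_trace_1_def matrix_vector_mult_def
        sum_distrib_left sum_distrib_right del: Re_sum)
  also have "\<dots> = Re (\<Sum>i\<in>UNIV. \<Sum>k\<in>UNIV. \<Sum>l\<in>UNIV. cnj (v $ k) * (\<Gamma> $ (i, k) $ (i, l) * v $ l))"
    by (simp only: sum.swap[where B = "UNIV :: 'a set"])
  also have "\<dots> = (\<Sum>i\<in>UNIV. w i \<bullet> (\<Gamma> *v w i))" unfolding * by simp
  also have "\<dots> \<ge> 0" using assms by (intro sum_nonneg) (simp add: psd_def)
  finally show "0 \<le> v \<bullet> (partial_trace_1 \<Gamma> *v v)" .
qed

section \<open>Convergence\<close>

lemma tendsto_trace [tendsto_intros]:
  "((f :: _ \<Rightarrow> complex ^ 'n ^ 'n) \<longlongrightarrow> A) F \<Longrightarrow> ((\<lambda>x. trace (f x)) \<longlongrightarrow> trace A) F"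
  unfolding trace_def by (intro tendsto_intros)

lemma tendsto_matrix_mult [tendsto_intros]:
  fixes A :: "complex ^ 'n ^ 'm" and B :: "complex ^ 'k ^ 'n"
  assumes "(f \<longlongrightarrow> A) F" "(g \<longlongrightarrow> B) F"
  shows "((\<lambda>x. f x ** g x) \<longlongrightarrow> A ** B) F"
  unfolding matrix_matrix_mult_def by (intro tendsto_intros assms)

lemma tendsto_partial_trace_2 [tendsto_intros]:
  "(f \<longlongrightarrow> \<Gamma>) F \<Longrightarrow> ((\<lambda>x. partial_trace_2 (f x)) \<longlongrightarrow> partial_trace_2 \<Gamma>) F"
  unfolding partial_trace_2_def by (intro tendsto_intros)

lemma tendsto_partial_trace_1 [tendsto_intros]:
  "(f \<longlongrightarrow> \<Gamma>) F \<Longrightarrow> ((\<lambda>x. partial_trace_1 (f x)) \<longlongrightarrow> partial_trace_1 \<Gamma>) F"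
  unfolding partial_trace_1_def by (intro tendsto_intros)

text \<open>Testing against matrix units extracts single entries, so weak* convergence gives
  entrywise convergence and hence norm convergence.\<close>

lemma limitin_psd_topologyD:
  fixes \<xi> :: "'i \<Rightarrow> complex ^ 'n ^ 'n"
  assumes "limitin psd_topology \<xi> \<Gamma> F"
  shows "\<forall>\<^sub>F t in F. psd (\<xi> t)" and "(\<xi> \<longlongrightarrow> \<Gamma>) F"
proof -
  have ev: "\<forall>\<^sub>F t in F. psd (\<xi> t)" and lim: "limitin weak_star_topology \<xi> \<Gamma> F"
    using assms by (auto simp: psd_topology_def limitin_subtopology)
  show "\<forall>\<^sub>F t in F. psd (\<xi> t)" by (fact ev)
  have "((\<lambda>t. \<xi> t $ i $ j) \<longlongrightarrow> \<Gamma> $ i $ j) F" for i j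
  proof (rule topological_tendstoI)
    fix V :: "complex set" assume V: "open V" "\<Gamma> $ i $ j \<in> V"
    \<comment> \<open>The indices are transposed: the unit sits at (j, i), so that
      \<open>trace (E ** M)\<close> is the entry of \<open>M\<close> at (i, j).\<close>
    define E :: "complex ^ 'n ^ 'n" where "E = (\<chi> a b. if a = j \<and> b = i then 1 else 0)"
    have "(E ** M) $ a $ b = (if a = j then M $ i $ b else 0)" for M :: "complex ^ 'n ^ 'n" and a b
      by (simp add: matrix_matrix_mult_def E_def if_distrib if_distribR cong: if_cong)
    then have tr: "trace (E ** M) = M $ i $ j" for M :: "complex ^ 'n ^ 'n"
      by (simp add: trace_def)
    have "openin weak_star_topology {M :: complex ^ 'n ^ 'n. trace (E ** M) \<in> V}"
      unfolding weak_star_topology_def using V(1) by (intro topology_generated_by_Basis) blast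
    then show "\<forall>\<^sub>F t in F. \<xi> t $ i $ j \<in> V"
      using lim V(2) by (auto simp: limitin_def tr)
  qed
  then show "(\<xi> \<longlongrightarrow> \<Gamma>) F" by (intro vec_tendstoI)
qed

text \<open>Klein's inequality for both marginals replaces the possibly infinite penalty by a real
  expression whose limit along a convergent family can be computed directly.\<close>

lemma unbalanced_functional_ge:
  fixes \<Gamma> :: "complex ^ ('a::finite \<times> 'b::finite) ^ ('a \<times> 'b)"
  assumes "psd \<Gamma>" "psd \<rho>" "psd \<sigma>" "0 \<le> \<tau>"
  shows "ereal (regularized_cost C \<epsilon> \<Gamma> + \<tau> *
      ((norm (partial_trace_2 \<Gamma> - \<rho>))\<^sup>2 / (2 * (Re (trace (partial_trace_2 \<Gamma>)) + Re (trace \<rho>)) + 1)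
     + (norm (partial_trace_1 \<Gamma> - \<sigma>))\<^sup>2 / (2 * (Re (trace (partial_trace_1 \<Gamma>)) + Re (trace \<sigma>)) + 1)))
     \<le> unbalanced_functional C \<rho> \<sigma> \<epsilon> \<tau> \<Gamma>"
  (is "ereal (_ + _ * (?q1 + ?q2)) \<le> _")
proof -
  have "ereal ?q1 + ereal ?q2 \<le> relative_entropy (partial_trace_2 \<Gamma>) \<rho> + relative_entropy (partial_trace_1 \<Gamma>) \<sigma>"
    by (rule add_mono[OF relative_entropy_bound[OF psd_partial_trace_2[OF assms(1)] assms(2)]
          relative_entropy_bound[OF psd_partial_trace_1[OF assms(1)] assms(3)]])
  then have "ereal \<tau> * (ereal ?q1 + ereal ?q2) \<le> ereal \<tau> * (relative_entropy (partial_trace_2 \<Gamma>) \<rho> + relative_entropy (partial_trace_1 \<Gamma>) \<sigma>)"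
    by (rule ereal_mult_left_mono) (use assms(4) in simp)
  then show ?thesis
    unfolding unbalanced_functional_def plus_ereal.simps(1)[symmetric] times_ereal.simps(1)[symmetric]
    by (rule add_left_mono)
qed

lemma unbalanced_functional_liminf:
  fixes C :: "complex ^ ('a::finite \<times> 'b::finite) ^ ('a \<times> 'b)"
    and \<rho> :: "complex ^ 'a ^ 'a" and \<sigma> :: "complex ^ 'b ^ 'b"
  assumes "\<epsilon> > 0" "psd \<rho>" "psd \<sigma>" "psd \<Gamma>" and lim: "limitin psd_topology \<xi> \<Gamma> at_top"
  shows "limit_functional C \<rho> \<sigma> \<epsilon> \<Gamma> \<le> Liminf at_top (\<lambda>\<tau>. unbalanced_functional C \<rho> \<sigma> \<epsilon> \<tau> (\<xi> \<tau>))"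
proof -
  \<comment> \<open>The lower bound for the sum of the two relative entropies. On positive
    semi-definite matrices both denominators are positive, so \<open>q\<close> is nonnegative and
    vanishes only where both marginals match.\<close>
  define q where "q M =
      (norm (partial_trace_2 M - \<rho>))\<^sup>2 / (2 * (Re (trace (partial_trace_2 M)) + Re (trace \<rho>)) + 1)
     + (norm (partial_trace_1 M - \<sigma>))\<^sup>2 / (2 * (Re (trace (partial_trace_1 M)) + Re (trace \<sigma>)) + 1)"
    for M :: "complex ^ ('a \<times> 'b) ^ ('a \<times> 'b)"
  have T1: "0 < 2 * (Re (trace (partial_trace_2 M)) + Re (trace \<rho>)) + 1"
    and T2: "0 < 2 * (Re (trace (partial_trace_1 M)) + Re (trace \<sigma>)) + 1"
    if "psd M" for M :: "complex ^ ('a \<times> 'b) ^ ('a \<times> 'b)"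
    using psd_trace_nonneg[OF psd_partial_trace_2[OF that]] psd_trace_nonneg[OF psd_partial_trace_1[OF that]]
      psd_trace_nonneg[OF assms(2)] psd_trace_nonneg[OF assms(3)] by auto
  have q0: "0 \<le> q M" if "psd M" for M
    unfolding q_def using T1[OF that] T2[OF that] by (intro add_nonneg_nonneg divide_nonneg_pos) auto
  have psd: "\<forall>\<^sub>F t in at_top. psd (\<xi> t)" and tends: "(\<xi> \<longlongrightarrow> \<Gamma>) at_top"
    using limitin_psd_topologyD[OF lim] by auto
  have q_lim: "((\<lambda>t. q (\<xi> t)) \<longlongrightarrow> q \<Gamma>) at_top"
    unfolding q_def using T1[OF assms(4)] T2[OF assms(4)]
    by (intro tendsto_intros tends) auto
  \<comment> \<open>A minorant serving both cases below: the entropy is replaced by an affine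
    function, so that its part \<open>l\<close> converges, while the penalty keeps its factor
    \<open>t\<close>.\<close>
  have "\<exists>l. (l \<longlongrightarrow> regularized_cost C \<epsilon> \<Gamma> - \<eta>) at_top \<and>
      (\<forall>\<^sub>F t in at_top. ereal (l t + t * q (\<xi> t)) \<le> unbalanced_functional C \<rho> \<sigma> \<epsilon> t (\<xi> t))"
    if "\<eta> > 0" for \<eta>
  proof -
    have "\<eta> / \<epsilon> > 0" using that assms(1) by simp
    then obtain L c where L: "\<And>B. psd B \<Longrightarrow> Re (trace (B ** L)) - c \<le> von_neumann_entropy B"
      "von_neumann_entropy \<Gamma> - \<eta> / \<epsilon> \<le> Re (trace (\<Gamma> ** L)) - c"
      using von_neumann_entropy_affine_minorant[OF assms(4)] by blast
    \<comment> \<open>The nonnegative slack of the affine minorant at \<Gamma>. Subtracting it keeps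
      a minorant and makes the limit of \<open>l\<close> exactly
      \<open>regularized_cost C \<epsilon> \<Gamma> - \<eta>\<close>.\<close>
    define r where "r = Re (trace (\<Gamma> ** L)) - c - (von_neumann_entropy \<Gamma> - \<eta> / \<epsilon>)"
    define l where "l t = Re (trace (C ** \<xi> t)) + \<epsilon> * (Re (trace (\<xi> t ** L)) - c - r)" for t
    have "(l \<longlongrightarrow> Re (trace (C ** \<Gamma>)) + \<epsilon> * (Re (trace (\<Gamma> ** L)) - c - r)) at_top"
      unfolding l_def by (intro tendsto_intros tends)
    also have "Re (trace (C ** \<Gamma>)) + \<epsilon> * (Re (trace (\<Gamma> ** L)) - c - r) = regularized_cost C \<epsilon> \<Gamma> - \<eta>"
      using assms(1) by (simp add: r_def regularized_cost_def algebra_simps)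
    finally have "(l \<longlongrightarrow> regularized_cost C \<epsilon> \<Gamma> - \<eta>) at_top" .
    moreover have "\<forall>\<^sub>F t in at_top. ereal (l t + t * q (\<xi> t)) \<le> unbalanced_functional C \<rho> \<sigma> \<epsilon> t (\<xi> t)"
      using psd eventually_ge_at_top[of 0]
    proof eventually_elim
      case (elim t)
      have "Re (trace (\<xi> t ** L)) - c - r \<le> von_neumann_entropy (\<xi> t)"
        using L(1)[OF elim(1)] L(2) by (simp add: r_def)
      then have "l t \<le> regularized_cost C \<epsilon> (\<xi> t)"
        using assms(1) by (simp add: l_def regularized_cost_def)
      then have "ereal (l t + t * q (\<xi> t)) \<le> ereal (regularized_cost C \<epsilon> (\<xi> t) + t * q (\<xi> t))"
        by simp
      also have "\<dots> \<le> unbalanced_functional C \<rho> \<sigma> \<epsilon> t (\<xi> t)"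
        unfolding q_def by (rule unbalanced_functional_ge[OF elim(1) assms(2,3) elim(2)])
      finally show ?case .
    qed
    ultimately show ?thesis by blast
  qed
  note minorant = this
  show ?thesis
  proof (cases "partial_trace_2 \<Gamma> = \<rho> \<and> partial_trace_1 \<Gamma> = \<sigma>")
    case True
    \<comment> \<open>With matching marginals the nonnegative term \<open>t * q (\<xi> t)\<close> is
      discarded for \<open>t \<ge> 0\<close>; afterwards \<eta> is arbitrary.\<close>
    have "ereal (regularized_cost C \<epsilon> \<Gamma>) - ereal \<eta> \<le> Liminf at_top (\<lambda>\<tau>. unbalanced_functional C \<rho> \<sigma> \<epsilon> \<tau> (\<xi> \<tau>))"
      if \<eta>: "\<eta> > 0" for \<eta>
    proof -
      obtain l where l: "(l \<longlongrightarrow> regularized_cost C \<epsilon> \<Gamma> - \<eta>) at_top"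
        and le: "\<forall>\<^sub>F t in at_top. ereal (l t + t * q (\<xi> t)) \<le> unbalanced_functional C \<rho> \<sigma> \<epsilon> t (\<xi> t)"
        using minorant[OF \<eta>] by blast
      have "((\<lambda>t. ereal (l t)) \<longlongrightarrow> ereal (regularized_cost C \<epsilon> \<Gamma> - \<eta>)) at_top"
        using l by simp
      then have "ereal (regularized_cost C \<epsilon> \<Gamma> - \<eta>) = Liminf at_top (\<lambda>t. ereal (l t))"
        by (rule lim_imp_Liminf[OF trivial_limit_at_top_linorder, symmetric])
      also have "\<dots> \<le> Liminf at_top (\<lambda>\<tau>. unbalanced_functional C \<rho> \<sigma> \<epsilon> \<tau> (\<xi> \<tau>))"
      proof (rule Liminf_mono)
        show "\<forall>\<^sub>F t in at_top. ereal (l t) \<le> unbalanced_functional C \<rho> \<sigma> \<epsilon> t (\<xi> t)"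
          using le psd eventually_ge_at_top[of 0]
        proof eventually_elim
          case (elim t)
          have "ereal (l t) \<le> ereal (l t + t * q (\<xi> t))" using q0[OF elim(2)] elim(3) by simp
          then show ?case using elim(1) by (rule order_trans)
        qed
      qed
      finally show ?thesis by simp
    qed
    then have "ereal (regularized_cost C \<epsilon> \<Gamma>) \<le> Liminf at_top (\<lambda>\<tau>. unbalanced_functional C \<rho> \<sigma> \<epsilon> \<tau> (\<xi> \<tau>)) + ereal \<eta>"
      if "\<eta> > 0" for \<eta>
      using that by (subst ereal_minus_le[symmetric]) simp_all
    then have "ereal (regularized_cost C \<epsilon> \<Gamma>) \<le> Liminf at_top (\<lambda>\<tau>. unbalanced_functional C \<rho> \<sigma> \<epsilon> \<tau> (\<xi> \<tau>))"
      by (rule ereal_le_epsilon2)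
    then show ?thesis using True by (simp add: limit_functional_def)
  next
    case False
    have "q \<Gamma> > 0"
    proof (cases "partial_trace_2 \<Gamma> = \<rho>")
      case True
      with False have "partial_trace_1 \<Gamma> \<noteq> \<sigma>" by simp
      then show ?thesis
        unfolding q_def
        by - ((rule add_nonneg_pos; rule divide_pos_pos[OF _ T1[OF assms(4)]] divide_pos_pos[OF _ T2[OF assms(4)]]
            divide_nonneg_pos[OF _ T1[OF assms(4)]] divide_nonneg_pos[OF _ T2[OF assms(4)]]); simp)
    next
      case False
      then show ?thesis
        unfolding q_def
        by - ((rule add_pos_nonneg; rule divide_pos_pos[OF _ T1[OF assms(4)]] divide_pos_pos[OF _ T2[OF assms(4)]]
            divide_nonneg_pos[OF _ T1[OF assms(4)]] divide_nonneg_pos[OF _ T2[OF assms(4)]]); simp)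
    qed
    obtain l where l: "(l \<longlongrightarrow> regularized_cost C \<epsilon> \<Gamma> - 1) at_top"
      and le: "\<forall>\<^sub>F t in at_top. ereal (l t + t * q (\<xi> t)) \<le> unbalanced_functional C \<rho> \<sigma> \<epsilon> t (\<xi> t)"
      using minorant[of 1] by auto
    \<comment> \<open>A convergent term plus \<open>t\<close> times a quantity with a strictly
      positive limit. The choice \<eta> = 1 is arbitrary here, as only a finite limit of
      \<open>l\<close> matters.\<close>
    have "filterlim (\<lambda>t. l t + t * q (\<xi> t)) at_top at_top"
      using filterlim_tendsto_pos_mult_at_top[OF q_lim \<open>q \<Gamma> > 0\<close> filterlim_ident]
      by (intro filterlim_tendsto_add_at_top[OF l]) (simp add: mult.commute)
    then have "((\<lambda>t. ereal (l t + t * q (\<xi> t))) \<longlongrightarrow> \<infinity>) at_top"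
      by (simp add: tendsto_PInfty filterlim_at_top_dense)
    then have "Liminf at_top (\<lambda>t. ereal (l t + t * q (\<xi> t))) = \<infinity>"
      by (simp add: lim_imp_Liminf)
    then have "Liminf at_top (\<lambda>\<tau>. unbalanced_functional C \<rho> \<sigma> \<epsilon> \<tau> (\<xi> \<tau>)) = \<infinity>"
      using Liminf_mono[OF le] by simp
    then show ?thesis by simp
  qed
qed

theorem proposition3p4:
  fixes \<epsilon> :: real
    and C :: "complex ^ ('a::finite \<times> 'b::finite) ^ ('a \<times> 'b)"
    and \<rho> :: "complex ^ 'a ^ 'a" and \<sigma> :: "complex ^ 'b ^ 'b"
  assumes "\<epsilon> > 0" and "hermitian C" and "psd \<rho>" and "psd \<sigma>"
  shows "gamma_converges psd_topology (\<lambda>\<tau>. unbalanced_functional C \<rho> \<sigma> \<epsilon> \<tau>)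
           (limit_functional C \<rho> \<sigma> \<epsilon>) (at_top :: real filter)
       \<and> (density_matrix \<rho> \<and> density_matrix \<sigma> \<longrightarrow>
            (\<forall>\<Gamma>. psd \<Gamma> \<longrightarrow> limit_functional C \<rho> \<sigma> \<epsilon> \<Gamma> = ncot_functional C \<rho> \<sigma> \<epsilon> \<Gamma>))"
proof (intro conjI impI allI)
  have "\<exists>\<xi>. limitin psd_topology \<xi> \<Gamma> at_top \<and>
      Limsup at_top (\<lambda>\<tau>. unbalanced_functional C \<rho> \<sigma> \<epsilon> \<tau> (\<xi> \<tau>)) \<le> limit_functional C \<rho> \<sigma> \<epsilon> \<Gamma>"
    if "psd \<Gamma>" for \<Gamma> :: "complex ^ ('a \<times> 'b) ^ ('a \<times> 'b)"
  proof (intro exI[of _ "\<lambda>_. \<Gamma>"] conjI)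
    show "limitin psd_topology (\<lambda>_. \<Gamma>) \<Gamma> at_top"
      using that by (simp add: topspace_psd_topology)
    \<comment> \<open>With matching marginals both relative entropies are zero and the functional is
      the same number for every \<tau>; otherwise the right-hand side is \<infinity>.\<close>
    show "Limsup at_top (\<lambda>\<tau>. unbalanced_functional C \<rho> \<sigma> \<epsilon> \<tau> \<Gamma>) \<le> limit_functional C \<rho> \<sigma> \<epsilon> \<Gamma>"
      by (auto simp: limit_functional_def unbalanced_functional_def relative_entropy_self Limsup_const)
  qed
  then show "gamma_converges psd_topology (\<lambda>\<tau>. unbalanced_functional C \<rho> \<sigma> \<epsilon> \<tau>)
      (limit_functional C \<rho> \<sigma> \<epsilon>) at_top"
    unfolding gamma_converges_def topspace_psd_topology
    using unbalanced_functional_liminf[OF assms(1,3,4)] by blast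
next
  fix \<Gamma> :: "complex ^ ('a \<times> 'b) ^ ('a \<times> 'b)"
  assume "density_matrix \<rho> \<and> density_matrix \<sigma>" "psd \<Gamma>"
  \<comment> \<open>The two constraints agree because the partial trace preserves the trace: a
    positive semi-definite \<Gamma> with first marginal \<rho> of trace one is itself a density
    matrix.\<close>
  then show "limit_functional C \<rho> \<sigma> \<epsilon> \<Gamma> = ncot_functional C \<rho> \<sigma> \<epsilon> \<Gamma>"
    using trace_partial_trace_2[of \<Gamma>]
    by (auto simp: limit_functional_def ncot_functional_def density_matrix_def)
qed

end
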